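(* Let $X$ be a nonempty set, let $\Theta\subseteq\mathbb{R}$ be a nondegenerate open interval, and let $\psi\in\Psi[Z_1](X,\Theta)$, with $\vartheta_1:=\vartheta_{1,\psi}:X\to\Theta$. Assume that, for all $z\in X$, the map $\Theta\setminus\{\vartheta_1(z)\}\ni t\mapsto\psi(z,t)$ is continuously differentiable and that, for all $t\in\Theta$, there exist $x,y\in X$ such that $\vartheta_1(x)<t<\vartheta_1(y)$. Then the following two assertions are equivalent: (i) For all $x,y\in X$ with $\vartheta_1(x)<\vartheta_1(y)$, the map $$(\vartheta_1(x),\vartheta_1(y))\ni t\mapsto -\frac{\psi(x,t)}{\psi(y,t)}$$ is increasing. (ii) There exists a positive and locally absolutely continuous function $p:\Theta\to\mathbb{R}$ such that, for all $z\in X$, the map $\Theta\ni t\mapsto p(t)\psi(z,t)$ is decreasing on $\Theta$ and locally absolutely continuous on $\Theta\setminus\{\vartheta_1(z)\}$.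
   Context: An interval is nondegenerate if it contains at least two distinct points. "Increasing" and "decreasing" are meant in the non-strict sense (strict versions are called "strictly increasing", "strictly decreasing"). $\Psi(X,\Theta)$ denotes the class of functions $\psi:X\times\Theta\to\mathbb{R}$ such that, for all $x\in X$, there exist $t_+,t_-\in\Theta$ with $t_+<t_-$ and $\psi(x,t_+)>0>\psi(x,t_-)$. $\Psi[Z_1](X,\Theta)$ denotes the class of those $\psi\in\Psi(X,\Theta)$ for which there exists a (necessarily unique) map $\vartheta_{1,\psi}:X\to\Theta$ such that, for all $x\in X$ and $t\in\Theta$: $\psi(x,t)>0$ if $t<\vartheta_{1,\psi}(x)$, $\psi(x,t)<0$ if $t>\vartheta_{1,\psi}(x)$, and $\psi(x,\vartheta_{1,\psi}(x))=0$. For an open set $U\subseteq\mathbb{R}$, a function $h:U\to\mathbb{R}$ is locally absolutely continuous if its restriction to any compact subinterval of $U$ is absolutely continuous. *)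

theory Defs
  imports "HOL-Analysis.Analysis"
begin

text \<open>A function on \<open>X \<times> \<Theta>\<close> is represented by a curried total function; its values outside
  \<open>X\<close> and \<open>\<Theta>\<close> are irrelevant.\<close>

definition Psi :: "'a set \<Rightarrow> real set \<Rightarrow> ('a \<Rightarrow> real \<Rightarrow> real) set" where
  "Psi X \<Theta> = {\<psi>. \<forall>x\<in>X. \<exists>tp\<in>\<Theta>. \<exists>tm\<in>\<Theta>. tp < tm \<and> \<psi> x tp > 0 \<and> 0 > \<psi> x tm}"

definition is_Z1_point :: "real set \<Rightarrow> (real \<Rightarrow> real) \<Rightarrow> real \<Rightarrow> bool" where
  "is_Z1_point \<Theta> g \<tau> \<longleftrightarrow> \<tau> \<in> \<Theta> \<and>
     (\<forall>t\<in>\<Theta>. (t < \<tau> \<longrightarrow> g t > 0) \<and> (t > \<tau> \<longrightarrow> g t < 0)) \<and> g \<tau> = 0"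

definition Psi_Z1 :: "'a set \<Rightarrow> real set \<Rightarrow> ('a \<Rightarrow> real \<Rightarrow> real) set" where
  "Psi_Z1 X \<Theta> = {\<psi> \<in> Psi X \<Theta>. \<exists>\<theta>. \<forall>x\<in>X. is_Z1_point \<Theta> (\<psi> x) (\<theta> x)}"

lemma is_Z1_point_unique:
  assumes "is_Z1_point \<Theta> g \<sigma>" "is_Z1_point \<Theta> g \<tau>"
  shows "\<sigma> = \<tau>"
  using assms unfolding is_Z1_point_def by (metis less_irrefl linorder_less_linear)

definition vartheta1 :: "real set \<Rightarrow> ('a \<Rightarrow> real \<Rightarrow> real) \<Rightarrow> 'a \<Rightarrow> real" where
  "vartheta1 \<Theta> \<psi> x = (THE \<tau>. is_Z1_point \<Theta> (\<psi> x) \<tau>)"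

lemma is_Z1_point_vartheta1:
  assumes "\<psi> \<in> Psi_Z1 X \<Theta>" "x \<in> X"
  shows "is_Z1_point \<Theta> (\<psi> x) (vartheta1 \<Theta> \<psi> x)"
proof -
  obtain \<tau> where "is_Z1_point \<Theta> (\<psi> x) \<tau>"
    using assms unfolding Psi_Z1_def by blast
  then show ?thesis
    unfolding vartheta1_def by (rule theI) (rule is_Z1_point_unique[OF _ \<open>is_Z1_point \<Theta> (\<psi> x) \<tau>\<close>])
qed

text \<open>Absolute continuity of functions; unrelated to \<^const>\<open>absolutely_continuous\<close>, which is about
  measures.\<close>

definition absolutely_continuous_fun_on :: "real set \<Rightarrow> (real \<Rightarrow> real) \<Rightarrow> bool" where
  "absolutely_continuous_fun_on I f \<longleftrightarrow>
     (\<forall>\<epsilon>>0. \<exists>\<delta>>0. \<forall>(n::nat) u v.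
        (\<forall>i<n. u i \<le> v i \<and> {u i..v i} \<subseteq> I) \<longrightarrow>
        disjoint_family_on (\<lambda>i. {u i<..<v i}) {..<n} \<longrightarrow>
        (\<Sum>i<n. v i - u i) < \<delta> \<longrightarrow>
        (\<Sum>i<n. \<bar>f (v i) - f (u i)\<bar>) < \<epsilon>)"

definition locally_absolutely_continuous_on :: "real set \<Rightarrow> (real \<Rightarrow> real) \<Rightarrow> bool" where
  "locally_absolutely_continuous_on U f \<longleftrightarrow>
     (\<forall>a b. {a..b} \<subseteq> U \<longrightarrow> absolutely_continuous_fun_on {a..b} f)"

end

theory Submission
  imports Defs
begin

text \<open>
  Write \<open>\<tau> z\<close> for the zero of \<open>\<psi> z\<close>.  That an integrating factor makes the ratios monotone is
  elementary: between \<open>\<tau> x\<close> and \<open>\<tau> y\<close> the ratio \<open>- \<psi> x / \<psi> y\<close> equals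
  \<open>(- p \<psi> x) / (p \<psi> y)\<close>, a positive increasing function over a positive decreasing one.

  For the converse, look for the factor as \<open>p = exp q\<close> and put \<open>l z = - \<psi> z' / \<psi> z\<close>, the derivative
  of \<open>- ln \<bar>\<psi> z\<bar>\<close>.  Then \<open>p \<psi> z\<close> decreases on both sides of \<open>\<tau> z\<close> as soon as \<open>q\<close> grows at least
  as fast as \<open>- ln \<bar>\<psi> z\<bar>\<close> to the right of \<open>\<tau> z\<close>, and at most as fast to the left of \<open>\<tau> z\<close>; at
  \<open>\<tau> z\<close> itself only signs matter.  So the derivative of \<open>q\<close> at \<open>t\<close> should be an upper bound of the
  \<open>l x t\<close> with \<open>\<tau> x < t\<close> and a lower bound of the \<open>l y t\<close> with \<open>t < \<tau> y\<close>.  Differentiating the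
  monotone ratios shows precisely that every number of the first kind is at most every number of the
  second kind (\<open>mono_on_ratio_imp_logderiv_le\<close>).  Hence \<open>L t = (SUP x. l x t)\<close>, taken over
  \<open>\<tau> x < t\<close>, has the required property pointwise; zeros on both sides of \<open>t\<close> make it finite.

  The function \<open>L\<close> need not be continuous, but it is a supremum of continuous functions on open sets
  and hence lower semicontinuous, in particular measurable
  (\<open>borel_measurable_SUP_open_domains\<close>).  On a compact interval one \<open>x\<close> with \<open>\<tau> x\<close> to its
  left and one \<open>y\<close> with \<open>\<tau> y\<close> to its right bound \<open>L\<close> from below and above by continuous functions.
  So \<open>L\<close> has a locally Lipschitz indefinite integral \<open>q\<close>, whose increments are bounded by those of
  \<open>- ln \<bar>\<psi> z\<bar>\<close> in the required directions because integration is monotone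
  (\<open>locally_lipschitz_between_slopes\<close>).  The products \<open>p \<psi> z\<close> are then even locally Lipschitz
  off \<open>\<tau> z\<close>, which is stronger than local absolute continuity.
\<close>

section \<open>Lipschitz functions and absolute continuity\<close>

lemma lipschitz_on_imp_absolutely_continuous_fun_on:
  fixes f :: "real \<Rightarrow> real"
  assumes "C-lipschitz_on I f"
  shows "absolutely_continuous_fun_on I f"
  unfolding absolutely_continuous_fun_on_def
proof (intro allI impI)
  fix \<epsilon> :: real assume "\<epsilon> > 0"
  have C: "C \<ge> 0" using assms by (rule lipschitz_on_nonneg)
  show "\<exists>\<delta>>0. \<forall>(n::nat) u v.
        (\<forall>i<n. u i \<le> v i \<and> {u i..v i} \<subseteq> I) \<longrightarrow>
        disjoint_family_on (\<lambda>i. {u i<..<v i}) {..<n} \<longrightarrow>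
        (\<Sum>i<n. v i - u i) < \<delta> \<longrightarrow>
        (\<Sum>i<n. \<bar>f (v i) - f (u i)\<bar>) < \<epsilon>"
    (* C + 1 instead of C, since C may be 0. *)
  proof (intro exI[of _ "\<epsilon> / (C + 1)"] conjI allI impI)
    show "\<epsilon> / (C + 1) > 0" using \<open>\<epsilon> > 0\<close> C by simp
    fix n :: nat and u v :: "nat \<Rightarrow> real"
    assume uv: "\<forall>i<n. u i \<le> v i \<and> {u i..v i} \<subseteq> I"
      and small: "(\<Sum>i<n. v i - u i) < \<epsilon> / (C + 1)"
    have "(\<Sum>i<n. \<bar>f (v i) - f (u i)\<bar>) \<le> (\<Sum>i<n. C * (v i - u i))"
    proof (rule sum_mono)
      fix i assume "i \<in> {..<n}"
      then have le: "u i \<le> v i" and "{u i..v i} \<subseteq> I" using uv by auto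
      then have "v i \<in> I" "u i \<in> I" by auto
      from lipschitz_onD[OF assms this] le show "\<bar>f (v i) - f (u i)\<bar> \<le> C * (v i - u i)"
        by (simp add: dist_real_def)
    qed
    also have "\<dots> = C * (\<Sum>i<n. v i - u i)" by (simp add: sum_distrib_left)
    also have "\<dots> \<le> (C + 1) * (\<Sum>i<n. v i - u i)"
      using uv by (intro mult_right_mono sum_nonneg) auto
    also have "\<dots> < \<epsilon>" using small C by (simp add: field_simps)
    finally show "(\<Sum>i<n. \<bar>f (v i) - f (u i)\<bar>) < \<epsilon>" .
  qed
qed

lemma locally_lipschitz_imp_locally_absolutely_continuous_on:
  fixes f :: "real \<Rightarrow> real"
  assumes "\<And>a b. {a..b} \<subseteq> U \<Longrightarrow> \<exists>C. C-lipschitz_on {a..b} f"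
  shows "locally_absolutely_continuous_on U f"
  using assms lipschitz_on_imp_absolutely_continuous_fun_on
  unfolding locally_absolutely_continuous_on_def by blast

lemma C1_differentiable_on_imp_lipschitz_on:
  fixes f :: "real \<Rightarrow> real"
  assumes "f C1_differentiable_on {a..b}"
  obtains C where "C-lipschitz_on {a..b} f"
proof -
  obtain D where D: "\<And>x. x \<in> {a..b} \<Longrightarrow> (f has_vector_derivative D x) (at x)"
    and cont: "continuous_on {a..b} D"
    using assms unfolding C1_differentiable_on_def by blast
  have "bounded (D ` {a..b})"
    by (intro compact_imp_bounded compact_continuous_image cont compact_Icc)
  then obtain C where C: "C > 0" "\<And>x. x \<in> {a..b} \<Longrightarrow> norm (D x) \<le> C"
    by (auto simp: bounded_pos)
  have "C-lipschitz_on {a..b} f"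
  proof (rule bounded_derivative_imp_lipschitz)
    fix x assume x: "x \<in> {a..b}"
    show "(f has_derivative (\<lambda>h. h *\<^sub>R D x)) (at x within {a..b})"
      using D[OF x] unfolding has_vector_derivative_def by (rule has_derivative_at_withinI)
    show "onorm (\<lambda>h. h *\<^sub>R D x) \<le> C"
      using mult_left_mono[OF C(2)[OF x] abs_ge_zero]
      by (intro onorm_le) (simp add: abs_mult mult.commute)
  qed (use C in auto)
  then show ?thesis by (rule that)
qed

lemma lipschitz_on_Icc_exp:
  fixes f :: "real \<Rightarrow> real"
  assumes "C-lipschitz_on {a..b} f"
  shows "\<exists>D. D-lipschitz_on {a..b} (\<lambda>t. exp (f t))"
proof -
  have "bounded (f ` {a..b})"
    by (intro compact_imp_bounded compact_continuous_image compact_Icc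
        lipschitz_on_continuous_on[OF assms])
  then obtain M where "\<And>x. x \<in> {a..b} \<Longrightarrow> \<bar>f x\<bar> \<le> M"
    unfolding bounded_iff by (metis imageI real_norm_def)
  then have M: "f ` {a..b} \<subseteq> {-M..M}" by (auto simp: abs_le_iff minus_le_iff)
  have "exp C1_differentiable_on {-M..M :: real}"
    unfolding C1_differentiable_on_def
    by (intro exI[of _ exp])
      (auto simp: has_real_derivative_iff_has_vector_derivative[symmetric] continuous_on_exp)
  then obtain E where "E-lipschitz_on {-M..M} (exp :: real \<Rightarrow> real)"
    by (rule C1_differentiable_on_imp_lipschitz_on)
  then have "E-lipschitz_on (f ` {a..b}) (exp :: real \<Rightarrow> real)"
    using M by (rule lipschitz_on_subset)
  from lipschitz_on_compose2[OF assms this] show ?thesis by (rule exI)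
qed

lemma lipschitz_on_Icc_mult:
  fixes f g :: "real \<Rightarrow> real"
  assumes f: "C-lipschitz_on {a..b} f" and g: "D-lipschitz_on {a..b} g"
  shows "\<exists>E. E-lipschitz_on {a..b} (\<lambda>t. f t * g t)"
proof -
  have "bounded (f ` {a..b})" "bounded (g ` {a..b})"
    by (intro compact_imp_bounded compact_continuous_image compact_Icc
        lipschitz_on_continuous_on[OF f] lipschitz_on_continuous_on[OF g])+
  then obtain M N where M: "M > 0" "\<And>x. x \<in> {a..b} \<Longrightarrow> \<bar>f x\<bar> \<le> M"
    and N: "N > 0" "\<And>x. x \<in> {a..b} \<Longrightarrow> \<bar>g x\<bar> \<le> N"
    by (auto simp: bounded_pos)
  have "(M * D + C * N)-lipschitz_on {a..b} (\<lambda>t. f t * g t)"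
  proof (rule lipschitz_onI)
    show "0 \<le> M * D + C * N"
      using M(1) N(1) lipschitz_on_nonneg[OF f] lipschitz_on_nonneg[OF g] by simp
    fix x y assume xy: "x \<in> {a..b}" "y \<in> {a..b}"
    have "f x * g x - f y * g y = f x * (g x - g y) + (f x - f y) * g y"
      by (simp add: algebra_simps)
    then have "\<bar>f x * g x - f y * g y\<bar> \<le> \<bar>f x\<bar> * \<bar>g x - g y\<bar> + \<bar>f x - f y\<bar> * \<bar>g y\<bar>"
      by (metis abs_mult abs_triangle_ineq)
    also have "\<dots> \<le> M * (D * \<bar>x - y\<bar>) + (C * \<bar>x - y\<bar>) * N"
      using M N xy lipschitz_onD[OF f xy] lipschitz_onD[OF g xy]
      by (intro add_mono mult_mono) (auto simp: dist_real_def)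
    finally show "dist (f x * g x) (f y * g y) \<le> (M * D + C * N) * dist x y"
      by (simp add: dist_real_def algebra_simps)
  qed
  then show ?thesis ..
qed

section \<open>Integrating a family of one-sided slope bounds\<close>

text \<open>If the supremum exceeds \<open>c\<close> at a point, then
  one of the functions does, and it goes on doing so in a neighbourhood within its own domain.  The superlevel
  sets are therefore traces of open sets on \<open>S\<close>, no matter how large the index set is.\<close>

lemma borel_measurable_SUP_open_domains:
  fixes l :: "'a \<Rightarrow> real \<Rightarrow> real" and V :: "'a \<Rightarrow> real set"
  assumes op: "\<And>x. x \<in> X \<Longrightarrow> open (V x)"
    and cont: "\<And>x. x \<in> X \<Longrightarrow> continuous_on (V x) (l x)"
    and ne: "\<And>t. t \<in> S \<Longrightarrow> \<exists>x\<in>X. t \<in> V x"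
    and bdd: "\<And>t. t \<in> S \<Longrightarrow> bdd_above ((\<lambda>x. l x t) ` {x\<in>X. t \<in> V x})"
  shows "(\<lambda>t. SUP x\<in>{x\<in>X. t \<in> V x}. l x t) \<in> borel_measurable (lebesgue_on S)"
  unfolding borel_measurable_iff_greater
proof
  fix c :: real
  let ?L = "\<lambda>t. SUP x\<in>{x\<in>X. t \<in> V x}. l x t"
  have "c < ?L t \<longleftrightarrow> (\<exists>x\<in>X. t \<in> V x \<and> c < l x t)" if "t \<in> S" for t
    using ne[OF that] bdd[OF that] by (subst less_cSUP_iff) auto
  then have "{t \<in> space (lebesgue_on S). c < ?L t} =
      S \<inter> (\<Union>x\<in>X. V x \<inter> {t. t \<in> V x \<and> c < l x t})"
    by (auto simp: space_restrict_space)
  moreover have "open (V x \<inter> {t. t \<in> V x \<and> c < l x t})" if "x \<in> X" for x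
  proof -
    have "open (V x \<inter> l x -` {c<..})"
      using continuous_on_open_vimage[OF op[OF that]] cont[OF that] 
      by (metis Int_commute open_greaterThan)
    moreover have "V x \<inter> {t. t \<in> V x \<and> c < l x t} = V x \<inter> l x -` {c<..}" by auto
    ultimately show ?thesis by simp
  qed
  then have "S \<inter> (\<Union>x\<in>X. V x \<inter> {t. t \<in> V x \<and> c < l x t}) \<in> sets (lebesgue_on S)"
    unfolding sets_restrict_space
    by (intro imageI sets_completionI_sets) (simp add: borel_open open_UN)
  ultimately show "{t \<in> space (lebesgue_on S). c < ?L t} \<in> sets (lebesgue_on S)"
    by simp
qed

text \<open>The integral over \<open>{a..b}\<close> vanishes for \<open>b < a\<close>, so the indefinite integral based at \<open>c\<close>
  has to be defined with an explicit sign on the left of \<open>c\<close>.\<close>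

lemma indefinite_integral_increment:
  fixes L :: "real \<Rightarrow> real"
  assumes int: "\<And>a b. {a..b} \<subseteq> \<Theta> \<Longrightarrow> L integrable_on {a..b}"
    and \<Theta>: "is_interval \<Theta>" and c: "c \<in> \<Theta>" and st: "s \<in> \<Theta>" "t \<in> \<Theta>" "s \<le> t"
  defines "q \<equiv> \<lambda>u. if c \<le> u then integral {c..u} L else - integral {u..c} L"
  shows "q t - q s = integral {s..t} L"
proof -
  have sub: "{a..b} \<subseteq> \<Theta>" if "a \<in> \<Theta>" "b \<in> \<Theta>" for a b
    using mem_is_interval_1_I[OF \<Theta> that] by auto
  consider "c \<le> s" | "s < c" "c \<le> t" | "t < c" by linarith
  then show ?thesis
  proof cases
    case 1
    then show ?thesis
      using Henstock_Kurzweil_Integration.integral_combine[OF 1 st(3) int[OF sub[OF c st(2)]]] st by (simp add: q_def)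
  next
    case 2
    then show ?thesis
      using Henstock_Kurzweil_Integration.integral_combine[OF _ 2(2) int[OF sub[OF st(1,2)]]] st by (simp add: q_def)
  next
    case 3
    then show ?thesis
      using Henstock_Kurzweil_Integration.integral_combine[OF st(3) _ int[OF sub[OF st(1) c]]] st by (simp add: q_def)
  qed
qed

text \<open>The analytic core: \<open>l x\<close> acts as a lower bound on the slope of \<open>q\<close> to the right of \<open>\<tau> x\<close> and as an
  upper bound to the left of it.  The bounds are compatible at each point, so the pointwise supremum
  of the lower ones satisfies all of them, and integrating it yields \<open>q\<close>.  The requirements on \<open>q\<close>
  are expressed by increments, since \<open>q\<close> need not be differentiable everywhere.\<close>

lemma locally_lipschitz_between_slopes:
  fixes \<Theta> :: "real set" and \<tau> :: "'a \<Rightarrow> real" and l :: "'a \<Rightarrow> real \<Rightarrow> real"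
  assumes op: "open \<Theta>" and int\<Theta>: "is_interval \<Theta>" and ne: "\<Theta> \<noteq> {}"
    and cont: "\<And>z. z \<in> X \<Longrightarrow> continuous_on (\<Theta> - {\<tau> z}) (l z)"
    and le: "\<And>x y t. \<lbrakk>x \<in> X; y \<in> X; t \<in> \<Theta>; \<tau> x < t; t < \<tau> y\<rbrakk> \<Longrightarrow> l x t \<le> l y t"
    and cofinal: "\<And>t. t \<in> \<Theta> \<Longrightarrow> \<exists>x\<in>X. \<exists>y\<in>X. \<tau> x < t \<and> t < \<tau> y"
  obtains q :: "real \<Rightarrow> real"
  where "\<And>a b. {a..b} \<subseteq> \<Theta> \<Longrightarrow> \<exists>C. C-lipschitz_on {a..b} q"
    and "\<And>z s t. \<lbrakk>z \<in> X; s \<in> \<Theta>; t \<in> \<Theta>; \<tau> z < s; s \<le> t\<rbrakk> \<Longrightarrow> integral {s..t} (l z) \<le> q t - q s"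
    and "\<And>z s t. \<lbrakk>z \<in> X; s \<in> \<Theta>; t \<in> \<Theta>; s \<le> t; t < \<tau> z\<rbrakk> \<Longrightarrow> q t - q s \<le> integral {s..t} (l z)"
proof -
  obtain c where c: "c \<in> \<Theta>" using ne by blast
  define V where "V x = \<Theta> \<inter> {\<tau> x<..}" for x
  define L where "L t = (SUP x\<in>{x\<in>X. t \<in> V x}. l x t)" for t
  have sub: "{a..b} \<subseteq> \<Theta>" if "a \<in> \<Theta>" "b \<in> \<Theta>" for a b
    using mem_is_interval_1_I[OF int\<Theta> that] by auto
  have bdd: "bdd_above ((\<lambda>x. l x t) ` {x\<in>X. t \<in> V x})" if t: "t \<in> \<Theta>" for t
  proof -
    obtain y where "y \<in> X" "t < \<tau> y" using cofinal[OF t] by blast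
    then show ?thesis using le[of _ y t] t by (auto simp: V_def intro!: bdd_aboveI2[of _ _ "l y t"])
  qed
  have L_ge: "l x t \<le> L t" if "x \<in> X" "t \<in> \<Theta>" "\<tau> x < t" for x t
    unfolding L_def using that by (intro cSUP_upper bdd) (auto simp: V_def)
  have L_le: "L t \<le> l y t" if "y \<in> X" "t \<in> \<Theta>" "t < \<tau> y" for y t
    unfolding L_def using that cofinal[OF that(2)] by (intro cSUP_least le) (auto simp: V_def)
  have L_bound: "\<exists>B. \<forall>t\<in>{a..b}. norm (L t) \<le> B" if ab: "{a..b} \<subseteq> \<Theta>" for a b
  proof (cases "a \<le> b")
    case True
    then have "a \<in> \<Theta>" "b \<in> \<Theta>" using ab by auto
    (* A single lower and a single upper slope serve the whole interval, because x has its \<tau> x to the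
       left of a and y has its \<tau> y to the right of b. *)
    then obtain x y where xy: "x \<in> X" "y \<in> X" "\<tau> x < a" "b < \<tau> y" using cofinal by meson
    have "continuous_on {a..b} (l x)" "continuous_on {a..b} (l y)"
      using xy ab by (auto intro!: continuous_on_subset[OF cont])
    then have "bounded (l x ` {a..b})" "bounded (l y ` {a..b})"
      by (auto intro!: compact_imp_bounded compact_continuous_image)
    then obtain M N where "\<And>t. t \<in> {a..b} \<Longrightarrow> \<bar>l x t\<bar> \<le> M" "\<And>t. t \<in> {a..b} \<Longrightarrow> \<bar>l y t\<bar> \<le> N"
      unfolding bounded_iff by (metis imageI real_norm_def)
    moreover have "l x t \<le> L t" "L t \<le> l y t" if "t \<in> {a..b}" for t
      using that xy ab by (auto intro!: L_ge L_le)
    ultimately show ?thesis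
      by (intro exI[of _ "max M N"]) (smt (verit, best) real_norm_def)
  qed simp
  have L_int: "L integrable_on {a..b}" if ab: "{a..b} \<subseteq> \<Theta>" for a b
  proof -
    obtain B where B: "\<And>t. t \<in> {a..b} \<Longrightarrow> norm (L t) \<le> B" using L_bound[OF ab] by blast
    have "L \<in> borel_measurable (lebesgue_on {a..b})"
      unfolding L_def
    proof (rule borel_measurable_SUP_open_domains)
      fix t assume "t \<in> {a..b}"
      then have "t \<in> \<Theta>" using ab by blast
      then show "bdd_above ((\<lambda>x. l x t) ` {x\<in>X. t \<in> V x})" "\<exists>x\<in>X. t \<in> V x"
        using bdd cofinal by (auto simp: V_def)
    qed (use op in \<open>auto simp: V_def intro!: continuous_on_subset[OF cont]\<close>)
    then show ?thesis
      by (rule measurable_bounded_by_integrable_imp_integrable[where g = "\<lambda>_. B"]) (use B in auto)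
  qed
  define q where "q u = (if c \<le> u then integral {c..u} L else - integral {u..c} L)" for u
  have q_diff: "q t - q s = integral {s..t} L" if "s \<in> \<Theta>" "t \<in> \<Theta>" "s \<le> t" for s t
    unfolding q_def by (rule indefinite_integral_increment[OF L_int int\<Theta> c that])
  show ?thesis
  proof (rule that[of q])
    fix a b assume ab: "{a..b} \<subseteq> \<Theta>"
    then obtain B where B: "\<And>t. t \<in> {a..b} \<Longrightarrow> norm (L t) \<le> B" using L_bound by blast
    have *: "\<bar>q t - q s\<bar> \<le> max B 0 * (t - s)" if st: "s \<in> {a..b}" "t \<in> {a..b}" "s \<le> t" for s t
    proof -
      have "s \<in> \<Theta>" "t \<in> \<Theta>" using st ab by auto
      moreover have "norm (integral {s..t} L) \<le> max B 0 * measure lborel {s..t}"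
        using st B L_int[OF sub[OF \<open>s \<in> \<Theta>\<close> \<open>t \<in> \<Theta>\<close>]]
        by (intro has_integral_bound_real[where f = L and S = "{}"])
          (force intro: max.coboundedI1)+
      ultimately show ?thesis using q_diff st(3) by simp
    qed
    have "(max B 0)-lipschitz_on {a..b} q"
    proof (rule lipschitz_onI)
      fix s t assume "s \<in> {a..b}" "t \<in> {a..b}"
      then show "dist (q s) (q t) \<le> max B 0 * dist s t"
        using *[of s t] *[of t s] by (cases "s \<le> t") (auto simp: dist_real_def abs_minus_commute)
    qed simp
    then show "\<exists>C. C-lipschitz_on {a..b} q" ..
  next
    fix z s t assume z: "z \<in> X" "s \<in> \<Theta>" "t \<in> \<Theta>" "\<tau> z < s" "s \<le> t"
    note st = sub[OF z(2,3)]
    have "l z integrable_on {s..t}"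
      using z st by (intro integrable_continuous_real continuous_on_subset[OF cont]) auto
    then show "integral {s..t} (l z) \<le> q t - q s"
      using z st by (subst q_diff) (auto intro!: integral_le L_int L_ge)
  next
    fix z s t assume z: "z \<in> X" "s \<in> \<Theta>" "t \<in> \<Theta>" "s \<le> t" "t < \<tau> z"
    note st = sub[OF z(2,3)]
    have "l z integrable_on {s..t}"
      using z st by (intro integrable_continuous_real continuous_on_subset[OF cont]) auto
    then show "q t - q s \<le> integral {s..t} (l z)"
      using z st by (subst q_diff) (auto intro!: integral_le L_int L_le)
  qed
qed

section \<open>Monotone ratios and the integrating factor\<close>

text \<open>Where \<open>f < 0 < g\<close>, the numerator of the derivative of \<open>f / g\<close> is \<open>f' g - f g'\<close>; dividing the sign
  condition by \<open>f g < 0\<close> turns it into a comparison of logarithmic derivatives, in which \<open>f\<close> and \<open>g\<close>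
  are separated.\<close>

lemma mono_on_ratio_imp_logderiv_le:
  fixes f g :: "real \<Rightarrow> real"
  assumes mono: "mono_on S (\<lambda>t. - (f t / g t))" and t: "t \<in> interior S"
    and f: "(f has_real_derivative f') (at t)" and g: "(g has_real_derivative g') (at t)"
    and sgn: "f t < 0" "g t > 0"
  shows "- f' / f t \<le> - g' / g t"
proof -
  have "((\<lambda>t. - (f t / g t)) has_real_derivative - ((f' * g t - f t * g') / (g t * g t))) (at t)"
    using sgn by (auto intro!: derivative_eq_intros f g)
  from mono_on_imp_deriv_nonneg[OF mono this t]
  have "(f' * g t - f t * g') / (g t * g t) \<le> 0" by simp
  then have "f' * g t \<le> f t * g'" using mult_pos_pos[OF sgn(2) sgn(2)] by (simp add: divide_le_0_iff)
  then show ?thesis using sgn by (simp add: field_simps)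
qed

text \<open>The logarithm on \<^typ>\<open>real\<close> is even (\<open>ln_minus\<close>), so \<open>ln (f s)\<close> is \<open>ln \<bar>f s\<bar>\<close> and negative
  \<open>f\<close> are covered too.\<close>

lemma integral_neg_logderiv:
  fixes f f' :: "real \<Rightarrow> real"
  assumes "s \<le> t"
    and f: "\<And>u. u \<in> {s..t} \<Longrightarrow> (f has_real_derivative f' u) (at u)"
    and nz: "\<And>u. u \<in> {s..t} \<Longrightarrow> f u \<noteq> 0"
  shows "integral {s..t} (\<lambda>u. - f' u / f u) = ln (f s) - ln (f t)"
proof -
  have "((\<lambda>u. - f' u / f u) has_integral (- ln (f t) - (- ln (f s)))) {s..t}"
  proof (rule fundamental_theorem_of_calculus[OF assms(1)])
    fix u assume u: "u \<in> {s..t}"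
    have "((\<lambda>u. - ln (f u)) has_real_derivative - f' u / f u) (at u)"
    proof (cases "f u > 0")
      case True
      then show ?thesis by (auto intro!: derivative_eq_intros f[OF u])
    next
      case False
      then have "((\<lambda>u. - ln (- f u)) has_real_derivative - f' u / f u) (at u)"
        using nz[OF u] by (auto intro!: derivative_eq_intros f[OF u])
      then show ?thesis by (simp add: ln_minus)
    qed
    then show "((\<lambda>u. - ln (f u)) has_vector_derivative - f' u / f u) (at u within {s..t})"
      by (simp add: has_real_derivative_iff_has_vector_derivative has_vector_derivative_at_within)
  qed
  from integral_unique[OF this] show ?thesis by linarith
qed

text \<open>The factor \<open>p\<close> cancels in the ratio, which is thus the quotient of the positive increasing
  \<open>- p f\<close> by the positive decreasing \<open>p g\<close>.\<close>

lemma mono_on_ratio_of_antimono: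
  fixes p f g :: "real \<Rightarrow> real"
  assumes f: "antimono_on S (\<lambda>t. p t * f t)" and g: "antimono_on S (\<lambda>t. p t * g t)"
    and pos: "\<And>t. t \<in> S \<Longrightarrow> p t > 0" "\<And>t. t \<in> S \<Longrightarrow> f t < 0" "\<And>t. t \<in> S \<Longrightarrow> g t > 0"
  shows "mono_on S (\<lambda>t. - (f t / g t))"
proof (rule mono_onI)
  fix s t assume st: "s \<in> S" "t \<in> S" "s \<le> t"
  have eq: "- (f u / g u) = - (p u * f u) / (p u * g u)" if "u \<in> S" for u
    using pos(1)[OF that] by simp
  have "- (p s * f s) / (p s * g s) \<le> - (p t * f t) / (p t * g t)"
  proof (rule frac_le)
    show "0 \<le> - (p t * f t)" using pos[OF st(2)] by (simp add: mult_nonneg_nonpos)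
    show "0 < p t * g t" using pos[OF st(2)] by simp
    show "- (p s * f s) \<le> - (p t * f t)" "p t * g t \<le> p s * g s"
      using monotone_onD[OF f st] monotone_onD[OF g st] by auto
  qed
  then show "- (f s / g s) \<le> - (f t / g t)" using st by (simp only: eq)
qed

theorem theorem2p1:
  fixes X :: "'a set" and \<Theta> :: "real set" and \<psi> :: "'a \<Rightarrow> real \<Rightarrow> real"
    and \<theta>\<^sub>1 :: "'a \<Rightarrow> real"
  assumes "X \<noteq> {}"
    and "open \<Theta>" and "is_interval \<Theta>" and "\<exists>a\<in>\<Theta>. \<exists>b\<in>\<Theta>. a \<noteq> b"
    and "\<psi> \<in> Psi_Z1 X \<Theta>"
    and "\<theta>\<^sub>1 = vartheta1 \<Theta> \<psi>"
    and "\<forall>z\<in>X. (\<lambda>t. \<psi> z t) C1_differentiable_on (\<Theta> - {\<theta>\<^sub>1 z})"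
    and "\<forall>t\<in>\<Theta>. \<exists>x\<in>X. \<exists>y\<in>X. \<theta>\<^sub>1 x < t \<and> t < \<theta>\<^sub>1 y"
  shows "(\<forall>x\<in>X. \<forall>y\<in>X. \<theta>\<^sub>1 x < \<theta>\<^sub>1 y \<longrightarrow>
            mono_on {\<theta>\<^sub>1 x<..<\<theta>\<^sub>1 y} (\<lambda>t. - (\<psi> x t / \<psi> y t)))
     \<longleftrightarrow>
         (\<exists>p :: real \<Rightarrow> real. (\<forall>t\<in>\<Theta>. p t > 0) \<and> locally_absolutely_continuous_on \<Theta> p \<and>
            (\<forall>z\<in>X. antimono_on \<Theta> (\<lambda>t. p t * \<psi> z t) \<and>
                    locally_absolutely_continuous_on (\<Theta> - {\<theta>\<^sub>1 z}) (\<lambda>t. p t * \<psi> z t)))"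
    (is "?ratios \<longleftrightarrow> ?factor")
proof -
  have Z1: "is_Z1_point \<Theta> (\<psi> z) (\<theta>\<^sub>1 z)" if "z \<in> X" for z
    using is_Z1_point_vartheta1[OF assms(5) that] assms(6) by simp
  have pos: "\<psi> z t > 0" if "z \<in> X" "t \<in> \<Theta>" "t < \<theta>\<^sub>1 z" for z t
    using Z1[OF that(1)] that unfolding is_Z1_point_def by blast
  have neg: "\<psi> z t < 0" if "z \<in> X" "t \<in> \<Theta>" "\<theta>\<^sub>1 z < t" for z t
    using Z1[OF that(1)] that unfolding is_Z1_point_def by blast
  have zero: "\<theta>\<^sub>1 z \<in> \<Theta>" "\<psi> z (\<theta>\<^sub>1 z) = 0" if "z \<in> X" for z
    using Z1[OF that] unfolding is_Z1_point_def by blast+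
  have between: "{s..t} \<subseteq> \<Theta>" if "s \<in> \<Theta>" "t \<in> \<Theta>" for s t
    using mem_is_interval_1_I[OF \<open>is_interval \<Theta>\<close> that] by auto
  show ?thesis
  proof
    assume ?factor
    then obtain p where p: "\<forall>t\<in>\<Theta>. p t > 0"
      and dec: "\<forall>z\<in>X. antimono_on \<Theta> (\<lambda>t. p t * \<psi> z t) \<and>
        locally_absolutely_continuous_on (\<Theta> - {\<theta>\<^sub>1 z}) (\<lambda>t. p t * \<psi> z t)"
      by (elim exE conjE)
    show ?ratios
    proof (intro ballI impI)
      fix x y assume xy: "x \<in> X" "y \<in> X" "\<theta>\<^sub>1 x < \<theta>\<^sub>1 y"
      have "{\<theta>\<^sub>1 x<..<\<theta>\<^sub>1 y} \<subseteq> {\<theta>\<^sub>1 x..\<theta>\<^sub>1 y}"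
        by (rule greaterThanLessThan_subseteq_atLeastAtMost_iff[THEN iffD2]) simp
      also have "\<dots> \<subseteq> \<Theta>" using xy by (intro between zero)
      finally have sub: "{\<theta>\<^sub>1 x<..<\<theta>\<^sub>1 y} \<subseteq> \<Theta>" .
      show "mono_on {\<theta>\<^sub>1 x<..<\<theta>\<^sub>1 y} (\<lambda>t. - (\<psi> x t / \<psi> y t))"
      proof (rule mono_on_ratio_of_antimono[where p = p])
        show "antimono_on {\<theta>\<^sub>1 x<..<\<theta>\<^sub>1 y} (\<lambda>t. p t * \<psi> x t)"
          "antimono_on {\<theta>\<^sub>1 x<..<\<theta>\<^sub>1 y} (\<lambda>t. p t * \<psi> y t)"
          using dec xy sub by (blast intro: monotone_on_subset)+
        fix t assume "t \<in> {\<theta>\<^sub>1 x<..<\<theta>\<^sub>1 y}"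
        then have t: "t \<in> \<Theta>" "\<theta>\<^sub>1 x < t" "t < \<theta>\<^sub>1 y" using sub by auto
        show "p t > 0" using p t(1) by blast
        show "\<psi> x t < 0" by (rule neg) fact+
        show "\<psi> y t > 0" by (rule pos) fact+
      qed
    qed
  next
    assume ratios: ?ratios
    have nz: "\<psi> z t \<noteq> 0" if "z \<in> X" "t \<in> \<Theta>" "t \<noteq> \<theta>\<^sub>1 z" for z t
      using pos neg that by (metis less_irrefl linorder_less_linear)
    obtain D where D: "\<And>z t. z \<in> X \<Longrightarrow> t \<in> \<Theta> - {\<theta>\<^sub>1 z} \<Longrightarrow> (\<psi> z has_real_derivative D z t) (at t)"
      and D_cont: "\<And>z. z \<in> X \<Longrightarrow> continuous_on (\<Theta> - {\<theta>\<^sub>1 z}) (D z)"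
      using assms(7) unfolding C1_differentiable_on_def has_real_derivative_iff_has_vector_derivative
      by metis
    have \<psi>_cont: "continuous_on (\<Theta> - {\<theta>\<^sub>1 z}) (\<psi> z)" if "z \<in> X" for z
      using D[OF that] by (intro continuous_at_imp_continuous_on ballI DERIV_isCont)
    define l where "l z t = - D z t / \<psi> z t" for z t
    have l_cont: "continuous_on (\<Theta> - {\<theta>\<^sub>1 z}) (l z)" if "z \<in> X" for z
      unfolding l_def using nz that by (intro continuous_intros D_cont \<psi>_cont) auto
    have l_le: "l x t \<le> l y t"
      if "x \<in> X" "y \<in> X" "t \<in> \<Theta>" "\<theta>\<^sub>1 x < t" "t < \<theta>\<^sub>1 y" for x y t
      unfolding l_def
    proof (rule mono_on_ratio_imp_logderiv_le[where f = "\<psi> x" and g = "\<psi> y"])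
      show "mono_on {\<theta>\<^sub>1 x<..<\<theta>\<^sub>1 y} (\<lambda>t. - (\<psi> x t / \<psi> y t))" using ratios that by auto
    qed (use that D pos neg in \<open>auto simp: interior_open\<close>)
    have l_int: "integral {s..t} (l z) = ln (\<psi> z s) - ln (\<psi> z t)"
      if "z \<in> X" "s \<in> \<Theta>" "t \<in> \<Theta>" "s \<le> t" "\<theta>\<^sub>1 z \<notin> {s..t}" for z s t
      unfolding l_def
      using that between[OF that(2,3)] by (intro integral_neg_logderiv D nz) auto
    have "\<Theta> \<noteq> {}" using assms(4) by blast
    have cofinal: "\<exists>x\<in>X. \<exists>y\<in>X. \<theta>\<^sub>1 x < t \<and> t < \<theta>\<^sub>1 y" if "t \<in> \<Theta>" for t using assms(8) that by blast
    obtain q where q_lip: "\<And>a b. {a..b} \<subseteq> \<Theta> \<Longrightarrow> \<exists>C. C-lipschitz_on {a..b} q"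
      and q_ge: "\<And>z s t. \<lbrakk>z \<in> X; s \<in> \<Theta>; t \<in> \<Theta>; \<theta>\<^sub>1 z < s; s \<le> t\<rbrakk> \<Longrightarrow> integral {s..t} (l z) \<le> q t - q s"
      and q_le: "\<And>z s t. \<lbrakk>z \<in> X; s \<in> \<Theta>; t \<in> \<Theta>; s \<le> t; t < \<theta>\<^sub>1 z\<rbrakk> \<Longrightarrow> q t - q s \<le> integral {s..t} (l z)"
      by (rule locally_lipschitz_between_slopes
          [OF \<open>open \<Theta>\<close> \<open>is_interval \<Theta>\<close> \<open>\<Theta> \<noteq> {}\<close> l_cont l_le cofinal]) blast+
    define p where "p t = exp (q t)" for t
    have p_lip: "\<exists>C. C-lipschitz_on {a..b} p" if "{a..b} \<subseteq> \<Theta>" for a b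
      unfolding p_def using q_lip[OF that] by (blast intro: lipschitz_on_Icc_exp)
    have abs_eq: "p t * \<bar>\<psi> z t\<bar> = exp (q t + ln (\<psi> z t))"
      if "z \<in> X" "t \<in> \<Theta>" "t \<noteq> \<theta>\<^sub>1 z" for z t
      unfolding p_def using nz[OF that] by (simp add: exp_add exp_ln_abs)
    show ?factor
    proof (intro exI[of _ p] conjI ballI)
      show "p t > 0" for t by (simp add: p_def)
      show "locally_absolutely_continuous_on \<Theta> p"
        by (rule locally_lipschitz_imp_locally_absolutely_continuous_on) (rule p_lip)
    next
      fix z assume z: "z \<in> X"
      show "locally_absolutely_continuous_on (\<Theta> - {\<theta>\<^sub>1 z}) (\<lambda>t. p t * \<psi> z t)"
      proof (rule locally_lipschitz_imp_locally_absolutely_continuous_on)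
        fix a b assume ab: "{a..b} \<subseteq> \<Theta> - {\<theta>\<^sub>1 z}"
        have "\<psi> z C1_differentiable_on {a..b}"
          using assms(7) z ab by (blast intro: C1_differentiable_on_subset)
        then obtain C where "C-lipschitz_on {a..b} (\<psi> z)"
          by (rule C1_differentiable_on_imp_lipschitz_on)
        moreover obtain D where "D-lipschitz_on {a..b} p" using p_lip ab by blast
        ultimately show "\<exists>E. E-lipschitz_on {a..b} (\<lambda>t. p t * \<psi> z t)"
          by (rule lipschitz_on_Icc_mult[rotated])
      qed
      show "antimono_on \<Theta> (\<lambda>t. p t * \<psi> z t)"
      proof (rule monotone_onI)
        fix s t assume st: "s \<in> \<Theta>" "t \<in> \<Theta>" "s \<le> t"
        have p_pos: "p u > 0" for u by (simp add: p_def)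
        (* On either side of the zero, the increments of q control \<bar>p \<psi>\<bar>, and the sign of \<psi> is constant;
           across the zero the signs alone decide. *)
        consider "\<theta>\<^sub>1 z < s" | "t < \<theta>\<^sub>1 z" | "s \<le> \<theta>\<^sub>1 z" "\<theta>\<^sub>1 z \<le> t" by linarith
        then show "p t * \<psi> z t \<le> p s * \<psi> z s"
        proof cases
          case 1
          then have "p s * \<bar>\<psi> z s\<bar> \<le> p t * \<bar>\<psi> z t\<bar>"
            using q_ge[OF z st(1,2) 1 st(3)] st by (simp add: abs_eq z l_int)
          then show ?thesis using neg[OF z st(1)] neg[OF z st(2)] 1 st(3) by (simp add: abs_of_neg)
        next
          case 2
          then have "p t * \<bar>\<psi> z t\<bar> \<le> p s * \<bar>\<psi> z s\<bar>"
            using q_le[OF z st 2] st by (simp add: abs_eq z l_int)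
          then show ?thesis using pos[OF z st(1)] pos[OF z st(2)] 2 st(3) by (simp add: abs_of_pos)
        next
          case 3
          then have "\<psi> z t \<le> 0" "0 \<le> \<psi> z s"
            using pos[OF z st(1)] neg[OF z st(2)] zero(2)[OF z] by force+
          then have "p t * \<psi> z t \<le> 0" "0 \<le> p s * \<psi> z s"
            using p_pos by (simp_all add: mult_nonneg_nonpos less_imp_le)
          then show ?thesis by linarith
        qed
      qed
    qed
  qed
qed

end
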